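(* Let $Y_1,Y_2,\ldots$ be independent identically distributed real random variables with mean $\mu$ and variance $\sigma^2$, $0<\sigma^2<\infty$, and suppose $\mathbb{E}|Y_1|^R<\infty$ for some integer $R\ge2$. Let $Z_n=\frac{1}{\sqrt n}\sum_{j=1}^n\frac{Y_j-\mu}{\sigma}$ and let $Z$ be a standard normal random variable. Then for any positive integer $r\le R$, $$\mathbb{E}(Z_n^r)-\mathbb{E}(Z^r)=\begin{cases}O(n^{-1/2}), & \text{if } r \text{ is odd},\\ O(n^{-1}), & \text{if } r \text{ is even},\end{cases}\qquad n\to\infty.$$ Specifically, if $r=2k+1\le R$, $$\lim_{n\to\infty}\sqrt{n}\,\mathbb{E}(Z_n^{2k+1})=\frac{k(2k+1)(2k-1)!!}{3\sigma^3}\,\mu_3,$$ and if $r=2k\le R$, $$\lim_{n\to\infty}n\left(\mathbb{E}(Z_n^{2k})-(2k-1)!!\right)=(2k-1)!!\left(\frac{(k)_2\,\mu_4}{6\sigma^4}+\frac{(k)_3\,\mu_3^2}{9\sigma^6}-\frac{(k)_2}{2}\right).$$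
   Context: $\mu_\nu=\mathbb{E}\big((Y_1-\mu)^\nu\big)$ is the $\nu$-th central moment of the $Y$'s. $(2k-1)!!=1\times3\times\cdots\times(2k-1)$, with $(-1)!!=1$. $(k)_m=k(k-1)\cdots(k-m+1)$ is the falling factorial (equal to $0$ when $k<m$). A term whose coefficient ($k$, $(k)_2$ or $(k)_3$) is zero is read as $0$, even if the moment multiplying it is not assumed to exist (this matters only for $r=1$ and $r=2$). *)

theory Defs
  imports "HOL-Probability.Probability" "HOL-Library.Landau_Symbols"
begin

(* Identical distribution is stated relative to Y 1 since the sequence is indexed from 1. *)
definition iid_sequence :: "'a measure \<Rightarrow> (nat \<Rightarrow> 'a \<Rightarrow> real) \<Rightarrow> bool" where
  "iid_sequence M Y \<longleftrightarrow>
     prob_space.indep_vars M (\<lambda>_. borel) Y {1..} \<and>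
     (\<forall>j\<ge>1. distr M borel (Y j) = distr M borel (Y 1))"

definition central_moment :: "'a measure \<Rightarrow> ('a \<Rightarrow> real) \<Rightarrow> nat \<Rightarrow> real" where
  "central_moment M X \<nu> = prob_space.expectation M (\<lambda>x. (X x - prob_space.expectation M X) ^ \<nu>)"

definition standardized_sum ::
    "(nat \<Rightarrow> 'a \<Rightarrow> real) \<Rightarrow> real \<Rightarrow> real \<Rightarrow> nat \<Rightarrow> 'a \<Rightarrow> real" where
  "standardized_sum Y \<mu> \<sigma> n x = 1 / sqrt (real n) * (\<Sum>j=1..n. (Y j x - \<mu>) / \<sigma>)"

(* odd_double_fact k is (2k-1)!! = 1 * 3 * ... * (2k-1); the argument is k, not 2k-1,
   so that the empty product covers (-1)!! = 1. *)
definition odd_double_fact :: "nat \<Rightarrow> real" where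
  "odd_double_fact k = (\<Prod>i=1..k. 2 * real i - 1)"

definition falling_fact :: "nat \<Rightarrow> nat \<Rightarrow> real" where
  "falling_fact k m = (\<Prod>i<m. real k - real i)"

end

theory Submission
  imports Defs "HOL-Computational_Algebra.Formal_Power_Series"
begin

text \<open>
Let \<open>m\<^sub>i\<close> be the moments of the standardized summands and \<open>A = \<Sum> m\<^sub>i x\<^sup>i / i!\<close> their (formal) moment
generating function. By independence the \<open>r\<close>-th moment of the sum of \<open>n\<close> summands is \<open>r!\<close> times the
\<open>x\<^sup>r\<close>-coefficient of \<open>A\<^sup>n\<close>. Since \<open>m\<^sub>0 = 1\<close> and \<open>m\<^sub>1 = 0\<close>, \<open>A = 1 + x\<^sup>2 C\<close>, so this coefficient is the sum of
\<open>binomial(n, j)\<close> times the \<open>x\<^bsup>r - 2j\<^esup>\<close>-coefficient of \<open>C\<^sup>j\<close> over \<open>j \<le> r/2\<close>. After division by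
\<open>n\<^bsup>r/2\<^esup>\<close> only the largest one (\<open>r\<close> odd) or two (\<open>r\<close> even) values of \<open>j\<close> contribute to the limit,
and these involve only the first three coefficients of \<open>C\<close>.
\<close>

unbundle no vec_syntax and fps_syntax

section \<open>Moments of independent sums as power series coefficients\<close>

text \<open>Splitting off the last summand, independence turns the binomial expansion into a Cauchy
  product of exponential generating functions. Existence and value of the moments go through one
  induction; the coefficient at \<open>r\<close> involves only \<open>m 0\<close>, ...,
  \<open>m r\<close>.\<close>

lemma (in prob_space) has_bochner_integral_sum_power:
  fixes X :: "nat \<Rightarrow> 'a \<Rightarrow> real" and m :: "nat \<Rightarrow> real"
  assumes indep: "indep_vars (\<lambda>_. borel) X {1..}"
    and moments: "\<And>j i. 1 \<le> j \<Longrightarrow> i \<le> R \<Longrightarrow> has_bochner_integral M (\<lambda>x. X j x ^ i) (m i)"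
    and "r \<le> R"
  shows "has_bochner_integral M (\<lambda>x. (\<Sum>j=1..n. X j x) ^ r)
           (fact r * fps_nth (Abs_fps (\<lambda>i. m i / fact i) ^ n) r)"
  using \<open>r \<le> R\<close>
proof (induction n arbitrary: r)
  case 0
  show ?case
  proof (cases "r = 0")
    case True
    then show ?thesis by (simp add: has_bochner_integral_iff prob_space)
  next
    case False
    then show ?thesis by (simp add: power_0_left has_bochner_integral_zero)
  qed
next
  case (Suc n)
  define A where "A = Abs_fps (\<lambda>i. m i / fact i)"
  define S where "S = (\<lambda>x. \<Sum>j=1..n. X j x)"
  have "indep_vars (\<lambda>_. borel) X (insert (Suc n) {1..n})"
    by (rule indep_vars_subset[OF indep]) auto
  then have ind: "indep_var borel (X (Suc n)) borel S"
    unfolding S_def by (intro indep_vars_sum) auto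
  \<comment> \<open>The factorials in \<open>r choose i\<close> cancel \<open>fact (r - i)\<close>
    and supply the \<open>1 / fact i\<close> of \<open>A $ i\<close>.\<close>
  have binomial_term: "has_bochner_integral M (\<lambda>x. (r choose i) * (X (Suc n) x ^ i * S x ^ (r - i)))
      (fact r * (A $ i * (A ^ n) $ (r - i)))" if "i \<le> r" for i
  proof -
    have 1: "has_bochner_integral M (\<lambda>x. X (Suc n) x ^ i) (m i)"
      using moments that Suc.prems by simp
    have 2: "has_bochner_integral M (\<lambda>x. S x ^ (r - i)) (fact (r - i) * (A ^ n) $ (r - i))"
      unfolding S_def A_def using Suc that by auto
    have "indep_var borel ((\<lambda>y. y ^ i) \<circ> X (Suc n)) borel ((\<lambda>y. y ^ (r - i)) \<circ> S)"
      by (rule indep_var_compose[OF ind]) auto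
    then have ind': "indep_var borel (\<lambda>x. X (Suc n) x ^ i) borel (\<lambda>x. S x ^ (r - i))"
      by (simp add: comp_def)
    have "has_bochner_integral M (\<lambda>x. X (Suc n) x ^ i * S x ^ (r - i))
        (m i * (fact (r - i) * (A ^ n) $ (r - i)))"
      using indep_var_integrable[OF ind'] indep_var_lebesgue_integral[OF ind'] 1 2
      by (simp add: has_bochner_integral_iff)
    from has_bochner_integral_mult_right[OF this, of "r choose i"] show ?thesis
      using that by (simp add: A_def binomial_fact)
  qed
  have "has_bochner_integral M
      (\<lambda>x. \<Sum>i\<le>r. (r choose i) * (X (Suc n) x ^ i * S x ^ (r - i)))
      (\<Sum>i\<le>r. fact r * (A $ i * (A ^ n) $ (r - i)))"
    by (rule has_bochner_integral_sum) (use binomial_term in auto)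
  moreover have "(\<Sum>j=1..Suc n. X j x) ^ r =
      (\<Sum>i\<le>r. (r choose i) * (X (Suc n) x ^ i * S x ^ (r - i)))" for x
    by (simp add: S_def add.commute[of _ "X (Suc n) x"] binomial_ring mult.assoc)
  ultimately show ?case
    by (simp add: A_def[symmetric] fps_mult_nth sum_distrib_left atMost_atLeast0)
qed

section \<open>Coefficients of powers of formal power series\<close>

text \<open>The \<open>j\<close>-th binomial term has order at least \<open>2 * j\<close>. The
  resulting range of summation does not depend on \<open>n\<close>, so limits in \<open>n\<close>
  can be taken termwise.\<close>

lemma one_plus_X_square_power_nth:
  fixes A C :: "'a :: comm_ring_1 fps"
  assumes "A = 1 + fps_X ^ 2 * C"
  shows "(A ^ n) $ r = (\<Sum>j\<le>r div 2. of_nat (n choose j) * (C ^ j) $ (r - 2 * j))"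
proof -
  have nth: "((fps_X ^ 2 * C) ^ j) $ r = (if r < 2 * j then 0 else (C ^ j) $ (r - 2 * j))" for j
    by (simp add: power_mult_distrib power_mult[symmetric] fps_X_power_mult_nth)
  have "A ^ n = (\<Sum>j\<le>n. of_nat (n choose j) * (fps_X ^ 2 * C) ^ j)"
    by (simp add: assms binomial_ring add.commute[of 1])
  then have "(A ^ n) $ r = (\<Sum>j\<le>n. of_nat (n choose j) * ((fps_X ^ 2 * C) ^ j) $ r)"
    by (simp add: fps_sum_nth fps_of_nat[symmetric] fps_mult_left_const_nth)
  \<comment> \<open>Either bound may be the larger one. Terms added here have a zero binomial
    coefficient, terms removed next have order above \<open>r\<close>.\<close>
  also have "\<dots> = (\<Sum>j\<le>max n (r div 2). of_nat (n choose j) * ((fps_X ^ 2 * C) ^ j) $ r)"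
    by (rule sum.mono_neutral_left) (simp_all add: not_le binomial_eq_0)
  also have "\<dots> = (\<Sum>j\<le>r div 2. of_nat (n choose j) * ((fps_X ^ 2 * C) ^ j) $ r)"
    by (rule sum.mono_neutral_right) (auto simp: nth)
  also have "\<dots> = (\<Sum>j\<le>r div 2. of_nat (n choose j) * (C ^ j) $ (r - 2 * j))"
    by (rule sum.cong) (auto simp: nth)
  finally show ?thesis .
qed

text \<open>One of the \<open>j\<close> factors contributes its linear coefficient. Dividing by
  \<open>C $ 0\<close> instead of writing the exponent \<open>j - 1\<close> avoids truncated
  subtraction at \<open>j = 0\<close>.\<close>

lemma fps_power_nth_one:
  fixes C :: "real fps"
  assumes "C $ 0 \<noteq> 0"
  shows "(C ^ j) $ 1 = j * (C $ 0) ^ j / C $ 0 * C $ 1"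
proof (induction j)
  case (Suc j)
  then show ?case using assms
    by (simp add: fps_mult_nth fps_power_zeroth field_simps)
qed simp

text \<open>Either one factor contributes its quadratic coefficient, or two distinct factors
  contribute their linear ones.\<close>

lemma fps_power_nth_two:
  fixes C :: "real fps"
  assumes "C $ 0 \<noteq> 0"
  shows "(C ^ j) $ 2 = (C $ 0) ^ j *
    (j * C $ 2 / C $ 0 + j * (real j - 1) / 2 * (C $ 1 / C $ 0)\<^sup>2)"
proof (induction j)
  case (Suc j)
  have "(C ^ Suc j) $ 2 = C $ 0 * (C ^ j) $ 2 + C $ 1 * (C ^ j) $ 1 + C $ 2 * (C ^ j) $ 0"
    by (simp add: fps_mult_nth numeral_2_eq_2)
  then show ?case using assms
    unfolding Suc fps_power_nth_one[OF assms] fps_power_zeroth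
    by (simp add: field_simps power2_eq_square)
qed simp

section \<open>Asymptotics of binomial coefficients\<close>

text \<open>These are the first two terms of the expansion in \<open>1 / n\<close>. They are proved
  together because the second-order induction step uses the first-order limit.\<close>

lemma binomial_over_power_tendsto:
  "(\<lambda>n. (n choose k) / real n ^ k) \<longlonglongrightarrow> 1 / fact k" (is "?A k")
  and binomial_over_power_second_order:
  "(\<lambda>n. real n * ((n choose k) / real n ^ k - 1 / fact k)) \<longlonglongrightarrow>
     - (real k * (real k - 1) / (2 * fact k))" (is "?B k")
proof -
  have "?A k \<and> ?B k"
  proof (induction k)
    case 0
    then show ?case by simp
  next
    case (Suc k)
    \<comment> \<open>For \<open>k > n\<close> both binomial coefficients vanish, so the negative
      factor \<open>real n - k\<close> does no harm.\<close>
    have rec: "real (n choose Suc k) = (n choose k) * (real n - k) / (k + 1)" for n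
    proof (cases "k \<le> n")
      case True
      have "Suc k * (n choose Suc k) = (n - k) * (n choose k)"
        by (metis binomial_absorb_comp binomial_absorption)
      then have "real (Suc k) * (n choose Suc k) = real (n - k) * (n choose k)"
        unfolding of_nat_mult[symmetric] by simp
      then show ?thesis using True by (simp add: of_nat_diff field_simps)
    qed (simp add: binomial_eq_0)
    \<comment> \<open>The subtracted term is of order \<open>1 / n\<close>: it disappears in the
      first limit and adds \<open>- k / fact k\<close> inside the second.\<close>
    have rec': "(n choose Suc k) / real n ^ Suc k =
        ((n choose k) / real n ^ k - k * ((n choose k) / real n ^ k) * (1 / n)) / (k + 1)"
      if "n > 0" for n
      using that by (simp add: rec field_simps)
    have ev: "eventually (\<lambda>n::nat. n > 0) sequentially" by (rule eventually_gt_at_top)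
    have A: "(\<lambda>n. (n choose k) / real n ^ k) \<longlonglongrightarrow> 1 / fact k"
      and B: "(\<lambda>n. real n * ((n choose k) / real n ^ k - 1 / fact k)) \<longlonglongrightarrow>
        - (real k * (real k - 1) / (2 * fact k))" using Suc by auto
    have "(\<lambda>n. ((n choose k) / real n ^ k - k * ((n choose k) / real n ^ k) * (1 / n)) / (k + 1))
        \<longlonglongrightarrow> (1 / fact k - k * (1 / fact k) * 0) / (k + 1)"
      by (intro tendsto_intros A lim_1_over_n) auto
    then have "?A (Suc k)"
      by (rule Lim_transform_eventually[OF _ eventually_mono[OF ev], THEN tendsto_eq_rhs])
        (simp_all only: rec', simp_all add: field_simps)
    have "(\<lambda>n. (real n * ((n choose k) / real n ^ k - 1 / fact k)
        - k * ((n choose k) / real n ^ k)) / (k + 1))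
        \<longlonglongrightarrow> (- (real k * (real k - 1) / (2 * fact k)) - k * (1 / fact k)) / (k + 1)"
      by (intro tendsto_intros A B) auto
    moreover have "(real n * (a - 1 / fact k) - k * a) / (k + 1) =
        real n * ((a - k * a * (1 / n)) / (k + 1) - 1 / fact (Suc k))" if "n > 0" for n and a :: real
      using that by (simp add: divide_simps) (simp add: algebra_simps)
    moreover have "(- (real k * (real k - 1) / (2 * fact k)) - k * (1 / fact k)) / (k + 1)
        = - (real (Suc k) * (real (Suc k) - 1) / (2 * fact (Suc k)))"
      by (simp add: divide_simps) (simp add: algebra_simps)
    ultimately have "?B (Suc k)"
      by (elim Lim_transform_eventually[THEN tendsto_eq_rhs])
        (auto intro!: eventually_mono[OF ev] simp only: rec')
    with \<open>?A (Suc k)\<close> show ?case ..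
  qed
  then show "?A k" "?B k" by auto
qed

lemma binomial_over_higher_power_tendsto:
  assumes "j < k"
  shows "(\<lambda>n. (n choose j) / real n ^ k) \<longlonglongrightarrow> 0"
proof -
  have "(\<lambda>n. (n choose j) / real n ^ j * (1 / real n) ^ (k - j)) \<longlonglongrightarrow> 1 / fact j * 0 ^ (k - j)"
    by (intro tendsto_intros binomial_over_power_tendsto lim_1_over_n)
  moreover have "(n choose j) / real n ^ j * (1 / real n) ^ (k - j) = (n choose j) / real n ^ k" for n
  proof -
    have "real n ^ k = real n ^ j * real n ^ (k - j)"
      using assms by (simp flip: power_add)
    then show ?thesis by (simp add: power_one_over)
  qed
  ultimately show ?thesis using assms by (simp add: power_0_left)
qed

section \<open>Closed forms, integrability and normal moments\<close>

text \<open>This is the form in which even normal moments are available, and the one that absorbs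
  the factor \<open>fact (2 * k)\<close> in front of the coefficients.\<close>

lemma odd_double_fact_eq: "odd_double_fact k = fact (2 * k) / (2 ^ k * fact k)"
proof (induction k)
  case (Suc k)
  have "odd_double_fact (Suc k) = (2 * real k + 1) * odd_double_fact k"
    by (simp add: odd_double_fact_def)
  also have "\<dots> = fact (2 * Suc k) / (2 ^ Suc k * fact (Suc k))"
    unfolding Suc by (simp add: divide_simps)
  finally show ?case .
qed (simp add: odd_double_fact_def)

lemma falling_fact_2: "falling_fact k 2 = real k * (real k - 1)"
  and falling_fact_3: "falling_fact k 3 = real k * (real k - 1) * (real k - 2)"
  by (simp_all add: falling_fact_def numeral_2_eq_2 numeral_3_eq_3)

text \<open>On a probability space \<open>1 + \<bar>X x\<bar> ^ R\<close> is an integrable majorant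
  of all lower powers.\<close>

lemma (in prob_space) integrable_power_le:
  fixes X :: "'a \<Rightarrow> real"
  assumes [measurable]: "X \<in> borel_measurable M"
    and "integrable M (\<lambda>x. \<bar>X x\<bar> ^ R)" and "i \<le> R"
  shows "integrable M (\<lambda>x. X x ^ i)"
proof (rule Bochner_Integration.integrable_bound)
  show "integrable M (\<lambda>x. 1 + \<bar>X x\<bar> ^ R)"
    using assms by simp
  have "\<bar>X x\<bar> ^ i \<le> 1 + \<bar>X x\<bar> ^ R" for x
  proof (cases "\<bar>X x\<bar> \<le> 1")
    case True
    then show ?thesis
      by (smt (verit) power_le_one abs_ge_zero zero_le_power)
  next
    case False
    then show ?thesis using power_increasing[OF \<open>i \<le> R\<close>, of "\<bar>X x\<bar>"] by linarith
  qed
  then show "AE x in M. norm (X x ^ i) \<le> norm (1 + \<bar>X x\<bar> ^ R)"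
    by (simp add: power_abs)
qed simp

lemma (in prob_space) integrable_affine_power:
  fixes X :: "'a \<Rightarrow> real"
  assumes "X \<in> borel_measurable M"
    and "integrable M (\<lambda>x. \<bar>X x\<bar> ^ R)" and "i \<le> R"
  shows "integrable M (\<lambda>x. ((X x - a) / b) ^ i)"
proof -
  have "integrable M (\<lambda>x. (\<Sum>l\<le>i. (i choose l) * X x ^ l * (- a) ^ (i - l)) / b ^ i)"
    using assms(3)
    by (intro integrable_divide Bochner_Integration.integrable_sum integrable_mult_left integrable_mult_right
        integrable_power_le[OF assms(1,2)]) auto
  then show ?thesis
    by (simp add: power_divide binomial_ring[symmetric])
qed

lemma distributed_std_normal_moment:
  assumes "distributed N lborel Z std_normal_density"
  shows "(\<integral>x. Z x ^ r \<partial>N) = (if even r then odd_double_fact (r div 2) else 0)"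
proof -
  have *: "(\<integral>x. std_normal_density x * x ^ r \<partial>lborel) = (\<integral>x. Z x ^ r \<partial>N)"
    by (rule distributed_integral[OF assms]) auto
  show ?thesis
  proof (cases "even r")
    case True
    then show ?thesis
      unfolding *[symmetric] by (auto simp: integral_std_normal_moment_even odd_double_fact_eq elim!: evenE)
  next
    case False
    then obtain k where "r = 2 * k + 1" by (elim oddE)
    then show ?thesis
      unfolding *[symmetric] using integral_std_normal_moment_odd[of k] by simp
  qed
qed

section \<open>Limits of normalized coefficients\<close>

text \<open>Only the top index \<open>j = k\<close> survives division by \<open>n ^ k\<close>,
  leaving the linear coefficient of \<open>C ^ k\<close>.\<close>

lemma fps_order_two_odd_limit:
  fixes C :: "real fps"
  assumes "C $ 0 = 1 / 2"
  shows "(\<lambda>n. (((1 + fps_X ^ 2 * C) ^ n) $ (2 * k + 1)) / real n ^ k) \<longlonglongrightarrow>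
    real k * 2 / 2 ^ k * C $ 1 / fact k"
proof -
  have "(\<lambda>n. \<Sum>j<k. (n choose j) / real n ^ k * (C ^ j) $ (2 * k + 1 - 2 * j))
      \<longlonglongrightarrow> (\<Sum>j<k. 0 * (C ^ j) $ (2 * k + 1 - 2 * j))"
    by (intro tendsto_sum tendsto_mult tendsto_const binomial_over_higher_power_tendsto) auto
  then have "(\<lambda>n. (\<Sum>j<k. (n choose j) / real n ^ k * (C ^ j) $ (2 * k + 1 - 2 * j))
      + (n choose k) / real n ^ k * (C ^ k) $ 1) \<longlonglongrightarrow>
      (\<Sum>j<k. 0 * (C ^ j) $ (2 * k + 1 - 2 * j)) + 1 / fact k * (C ^ k) $ 1"
    by (intro tendsto_add tendsto_mult tendsto_const binomial_over_power_tendsto)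
  moreover have "(C ^ k) $ 1 = real k * 2 / 2 ^ k * C $ 1"
    using fps_power_nth_one[of C k] assms by (simp add: power_one_over)
  ultimately show ?thesis
    by (simp add: one_plus_X_square_power_nth[OF refl] sum_divide_distrib add_divide_distrib
        lessThan_Suc_atMost[symmetric])
qed

text \<open>The top index \<open>j = k\<close> gives the leading constant, and its second-order
  binomial defect gives the \<open>- 1 / 2\<close>. The index \<open>j = k - 1\<close> gives the
  terms in \<open>C $ 1\<close> and \<open>C $ 2\<close>; smaller indices vanish.\<close>

lemma fps_order_two_even_limit:
  fixes C :: "real fps"
  assumes C0: "C $ 0 = 1 / 2"
  shows "(\<lambda>n. real n * (((1 + fps_X ^ 2 * C) ^ n) $ (2 * k) / real n ^ k - 1 / (2 ^ k * fact k)))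
    \<longlonglongrightarrow> (real k * (real k - 1) / (2 ^ k * fact k)) *
      (4 * C $ 2 + 4 * (real k - 2) * (C $ 1)\<^sup>2 - 1 / 2)"
proof (cases k)
  case 0
  then show ?thesis
    by (simp add: fps_power_zeroth)
next
  case (Suc p)
  \<comment> \<open>With \<open>p = k - 1\<close>, the outer factor \<open>n\<close> lowers the
    denominator from \<open>n ^ k\<close> to \<open>n ^ p\<close>.\<close>
  have lower: "(\<lambda>n. \<Sum>j<p. (n choose j) / real n ^ p * (C ^ j) $ (2 * k - 2 * j))
      \<longlonglongrightarrow> (\<Sum>j<p. 0 * (C ^ j) $ (2 * k - 2 * j))"
    by (intro tendsto_sum tendsto_mult tendsto_const binomial_over_higher_power_tendsto) auto
  have lim: "(\<lambda>n. (\<Sum>j<p. (n choose j) / real n ^ p * (C ^ j) $ (2 * k - 2 * j))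
      + (n choose p) / real n ^ p * (C ^ p) $ 2
      + real n * ((n choose k) / real n ^ k - 1 / fact k) * (C ^ k) $ 0) \<longlonglongrightarrow>
      (\<Sum>j<p. 0 * (C ^ j) $ (2 * k - 2 * j)) + 1 / fact p * (C ^ p) $ 2
      + (- (real k * (real k - 1) / (2 * fact k))) * (C ^ k) $ 0"
    by (intro tendsto_add tendsto_mult tendsto_const lower binomial_over_power_tendsto binomial_over_power_second_order)
  have eq: "(\<Sum>j<p. (n choose j) / real n ^ p * (C ^ j) $ (2 * k - 2 * j))
      + (n choose p) / real n ^ p * (C ^ p) $ 2
      + real n * ((n choose k) / real n ^ k - 1 / fact k) * (C ^ k) $ 0
      = real n * (((1 + fps_X ^ 2 * C) ^ n) $ (2 * k) / real n ^ k - 1 / (2 ^ k * fact k))"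
    if "n > 0" for n
  proof -
    define L where "L = (\<Sum>j<p. (n choose j) * (C ^ j) $ (2 * k - 2 * j)) + (n choose p) * (C ^ p) $ 2"
    have top: "((1 + fps_X ^ 2 * C) ^ n) $ (2 * k) = L + (n choose k) / 2 ^ k"
      by (simp add: one_plus_X_square_power_nth[OF refl] Suc lessThan_Suc_atMost[symmetric]
          L_def C0 fps_power_zeroth power_one_over del: binomial_Suc_Suc)
    have "real n * (((1 + fps_X ^ 2 * C) ^ n) $ (2 * k) / real n ^ k - 1 / (2 ^ k * fact k))
        = L / real n ^ p + real n * ((n choose k) / real n ^ k - 1 / fact k) * (C ^ k) $ 0"
      unfolding top using that by (simp add: C0 fps_power_zeroth power_one_over Suc field_simps del: binomial_Suc_Suc fact_Suc)
    then show ?thesis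
      by (simp add: L_def add_divide_distrib sum_divide_distrib)
  qed
  have "1 / fact p * (C ^ p) $ 2 + (- (real k * (real k - 1) / (2 * fact k))) * (C ^ k) $ 0
      = (real k * (real k - 1) / (2 ^ k * fact k)) *
      (4 * C $ 2 + 4 * (real k - 2) * (C $ 1)\<^sup>2 - 1 / 2)"
  proof -
    have c2: "(C ^ p) $ 2 = 2 / 2 ^ k * (2 * (real k - 1) * C $ 2
        + 2 * (real k - 1) * (real k - 2) * (C $ 1)\<^sup>2)"
      using fps_power_nth_two[of C p] C0
      by (simp add: Suc power_one_over power_divide field_simps)
    have fact_p: "1 / fact p = real k / fact k"
      by (simp add: Suc)
    show ?thesis
      unfolding c2 fps_power_zeroth C0 fact_p
      by (simp add: power_one_over field_simps power2_eq_square)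
  qed
  with lim have "(\<lambda>n. (\<Sum>j<p. (n choose j) / real n ^ p * (C ^ j) $ (2 * k - 2 * j))
      + (n choose p) / real n ^ p * (C ^ p) $ 2
      + real n * ((n choose k) / real n ^ k - 1 / fact k) * (C ^ k) $ 0) \<longlonglongrightarrow>
      (real k * (real k - 1) / (2 ^ k * fact k)) *
      (4 * C $ 2 + 4 * (real k - 2) * (C $ 1)\<^sup>2 - 1 / 2)"
    by simp
  then show ?thesis
    by (rule Lim_transform_eventually)
      (use eq in \<open>auto intro!: eventually_mono[OF eventually_gt_at_top[of 0]]\<close>)
qed

section \<open>Transfer to standardized sums\<close>

theorem theorem3:
  fixes M :: "'a measure" and Y :: "nat \<Rightarrow> 'a \<Rightarrow> real"
    and N :: "'b measure" and Z :: "'b \<Rightarrow> real"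
    and \<mu> \<sigma> :: real and R :: nat
  assumes "prob_space M"
    and "iid_sequence M Y"
    and "integrable M (Y 1)"
    and "prob_space.expectation M (Y 1) = \<mu>"
    and "integrable M (\<lambda>x. (Y 1 x)\<^sup>2)"
    and "prob_space.variance M (Y 1) = \<sigma>\<^sup>2"
    and "\<sigma> > 0"
    and "R \<ge> 2"
    and "integrable M (\<lambda>x. \<bar>Y 1 x\<bar> ^ R)"
    and "prob_space N"
    and "distributed N lborel Z std_normal_density"
  shows
    "(\<forall>r. 1 \<le> r \<and> r \<le> R \<longrightarrow>
        (odd r \<longrightarrow>
          (\<lambda>n. prob_space.expectation M (\<lambda>x. standardized_sum Y \<mu> \<sigma> n x ^ r)
                - prob_space.expectation N (\<lambda>x. Z x ^ r))
            \<in> O(\<lambda>n. real n powr (-1/2))) \<and>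
        (even r \<longrightarrow>
          (\<lambda>n. prob_space.expectation M (\<lambda>x. standardized_sum Y \<mu> \<sigma> n x ^ r)
                - prob_space.expectation N (\<lambda>x. Z x ^ r))
            \<in> O(\<lambda>n. 1 / real n))) \<and>
     (\<forall>k. 2 * k + 1 \<le> R \<longrightarrow>
        (\<lambda>n. sqrt (real n)
              * prob_space.expectation M (\<lambda>x. standardized_sum Y \<mu> \<sigma> n x ^ (2 * k + 1)))
          \<longlonglongrightarrow> real k * (2 * real k + 1) * odd_double_fact k / (3 * \<sigma> ^ 3)
                * central_moment M (Y 1) 3) \<and>
     (\<forall>k. 1 \<le> k \<and> 2 * k \<le> R \<longrightarrow>
        (\<lambda>n. real n
              * (prob_space.expectation M (\<lambda>x. standardized_sum Y \<mu> \<sigma> n x ^ (2 * k))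
                 - odd_double_fact k))
          \<longlonglongrightarrow> odd_double_fact k *
                (falling_fact k 2 * central_moment M (Y 1) 4 / (6 * \<sigma> ^ 4)
                 + falling_fact k 3 * (central_moment M (Y 1) 3)\<^sup>2 / (9 * \<sigma> ^ 6)
                 - falling_fact k 2 / 2))"
proof -
  interpret prob_space M by fact
  define X where "X j x = (Y j x - \<mu>) / \<sigma>" for j x
  \<comment> \<open>For \<open>i > R\<close> the integral may be the junk value 0, but only coefficients up to \<open>R\<close> of \<open>A\<close> are
    ever turned into expectations.\<close>
  define m where "m i = expectation (\<lambda>x. X 1 x ^ i)" for i
  define A where "A = Abs_fps (\<lambda>i. m i / fact i)"
  define C where "C = Abs_fps (\<lambda>i. m (i + 2) / fact (i + 2))"
  define E where "E n r = expectation (\<lambda>x. standardized_sum Y \<mu> \<sigma> n x ^ r)" for n r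
  have Y_indep: "indep_vars (\<lambda>_. borel) Y {1..}"
    and Y_distr: "\<And>j. 1 \<le> j \<Longrightarrow> distr M borel (Y j) = distr M borel (Y 1)"
    using \<open>iid_sequence M Y\<close> unfolding iid_sequence_def by blast+
  have Y_meas: "Y j \<in> borel_measurable M" if "1 \<le> j" for j
    using Y_indep that by (auto simp: indep_vars_def)
  have X_indep: "indep_vars (\<lambda>_. borel) X {1..}"
    unfolding X_def by (rule indep_vars_compose2[OF Y_indep]) auto
  have X1_int: "integrable M (\<lambda>x. X 1 x ^ i)" if "i \<le> R" for i
    unfolding X_def using Y_meas[of 1] assms that by (intro integrable_affine_power) auto
  have moments: "has_bochner_integral M (\<lambda>x. X j x ^ i) (m i)" if "1 \<le> j" "i \<le> R" for i j
  proof -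
    define g where "g y = ((y - \<mu>) / \<sigma>) ^ i" for y
    have [measurable]: "g \<in> borel_measurable borel" unfolding g_def by measurable
    have "integrable (distr M borel (Y j)) g"
      unfolding Y_distr[OF \<open>1 \<le> j\<close>] using X1_int[OF \<open>i \<le> R\<close>] Y_meas[of 1] by (simp add: integrable_distr_eq g_def X_def)
    moreover have "integral\<^sup>L (distr M borel (Y j)) g = m i"
      unfolding Y_distr[OF \<open>1 \<le> j\<close>] using Y_meas[of 1] by (simp add: integral_distr g_def X_def m_def)
    ultimately show ?thesis
      using Y_meas[OF \<open>1 \<le> j\<close>]
      by (simp add: integrable_distr_eq integral_distr
          has_bochner_integral_iff g_def X_def)
  qed
  \<comment> \<open>Constants pull out of the integral even where it takes its default value, so
    \<open>m 3\<close> and \<open>m 4\<close> need no case split for small \<open>R\<close>; their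
    coefficients are then zero.\<close>
  have central: "central_moment M (Y 1) i = \<sigma> ^ i * m i" for i
    using \<open>\<sigma> > 0\<close> \<open>expectation (Y 1) = \<mu>\<close>
    by (simp add: central_moment_def m_def X_def power_divide)
  have "m 0 = 1" by (simp add: m_def prob_space)
  have "m 1 = 0"
    using assms(3,4) by (simp add: m_def X_def prob_space)
  have "m 2 = 1"
    using central[of 2] assms(6) \<open>\<sigma> > 0\<close> by (simp add: central_moment_def)
  have A_eq: "A = 1 + fps_X ^ 2 * C"
  proof (rule fps_ext)
    fix i :: nat
    consider "i = 0" | "i = 1" | j where "i = j + 2"
      by (metis One_nat_def add_2_eq_Suc' not0_implies_Suc)
    then show "A $ i = (1 + fps_X ^ 2 * C) $ i"
      using \<open>m 0 = 1\<close> \<open>m 1 = 0\<close>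
      by cases (simp_all add: A_def C_def fps_X_power_mult_nth)
  qed
  have C0: "C $ 0 = 1 / 2" and C1: "C $ 1 = m 3 / 6" and C2: "C $ 2 = m 4 / 24"
    using \<open>m 2 = 1\<close> by (simp_all add: C_def fact_numeral numeral_2_eq_2[symmetric])
  have E_eq: "E n r = fact r * ((A ^ n) $ r) / sqrt (real n) ^ r" if "r \<le> R" for n r
  proof -
    have "has_bochner_integral M (\<lambda>x. (\<Sum>j=1..n. X j x) ^ r) (fact r * (A ^ n) $ r)"
      unfolding A_def by (rule has_bochner_integral_sum_power[OF X_indep moments that])
    moreover have "standardized_sum Y \<mu> \<sigma> n x ^ r = (\<Sum>j=1..n. X j x) ^ r / sqrt (real n) ^ r" for x
      by (simp add: standardized_sum_def X_def power_divide)
    ultimately show ?thesis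
      by (simp add: E_def has_bochner_integral_iff)
  qed
  have ev: "eventually (\<lambda>n::nat. n > 0) sequentially" by (rule eventually_gt_at_top)
  have odd_limit: "(\<lambda>n. sqrt (real n) * E n (2 * k + 1)) \<longlonglongrightarrow>
      real k * (2 * real k + 1) * odd_double_fact k / (3 * \<sigma> ^ 3) * central_moment M (Y 1) 3"
    if "2 * k + 1 \<le> R" for k
  proof -
    have "fact (2 * k + 1) * (((1 + fps_X ^ 2 * C) ^ n) $ (2 * k + 1) / real n ^ k)
        = sqrt (real n) * E n (2 * k + 1)" if "n > 0" for n
      unfolding E_eq[OF \<open>2 * k + 1 \<le> R\<close>] A_eq using that
      by (simp add: power_mult del: fact_Suc)
    then have transform: "eventually (\<lambda>n. fact (2 * k + 1) * (((1 + fps_X ^ 2 * C) ^ n) $ (2 * k + 1) / real n ^ k)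
        = sqrt (real n) * E n (2 * k + 1)) sequentially"
      by (rule eventually_mono[OF ev])
    \<comment> \<open>\<open>fact (2 * k + 1) / (2 ^ k * fact k)\<close> is
      \<open>(2 * k + 1) * odd_double_fact k\<close>, and
      \<open>2 * C $ 1 = m 3 / 3\<close>.\<close>
    have limit: "fact (2 * k + 1) * (real k * 2 / 2 ^ k * C $ 1 / fact k) =
        real k * (2 * real k + 1) * odd_double_fact k / (3 * \<sigma> ^ 3) * central_moment M (Y 1) 3"
      unfolding C1 central odd_double_fact_eq using \<open>\<sigma> > 0\<close> by (simp add: field_simps)
    show ?thesis
      unfolding limit[symmetric]
      by (rule Lim_transform_eventually[OF tendsto_mult[OF tendsto_const
            fps_order_two_odd_limit[OF C0]] transform])
  qed
  have even_limit: "(\<lambda>n. real n * (E n (2 * k) - odd_double_fact k)) \<longlonglongrightarrow>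
      odd_double_fact k *
        (falling_fact k 2 * central_moment M (Y 1) 4 / (6 * \<sigma> ^ 4)
         + falling_fact k 3 * (central_moment M (Y 1) 3)\<^sup>2 / (9 * \<sigma> ^ 6)
         - falling_fact k 2 / 2)" (is "_ \<longlonglongrightarrow> ?L")
    if "2 * k \<le> R" for k
  proof -
    have "fact (2 * k) *
        (real n * (((1 + fps_X ^ 2 * C) ^ n) $ (2 * k) / real n ^ k - 1 / (2 ^ k * fact k)))
        = real n * (E n (2 * k) - odd_double_fact k)" for n
    proof -
      have root: "sqrt (real n) ^ (2 * k) = real n ^ k"
        by (simp add: power_mult)
      show ?thesis
        unfolding E_eq[OF that] A_eq odd_double_fact_eq root
        by (simp add: algebra_simps)
    qed
    \<comment> \<open>The denominators 6 and 9 come from \<open>4 * C $ 2 = m 4 / 6\<close> and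
      \<open>4 * (C $ 1)\<^sup>2 = (m 3)\<^sup>2 / 9\<close>.\<close>
    moreover have "fact (2 * k) * ((real k * (real k - 1) / (2 ^ k * fact k)) *
        (4 * C $ 2 + 4 * (real k - 2) * (C $ 1)\<^sup>2 - 1 / 2)) = ?L"
    proof -
      have "central_moment M (Y 1) 4 / (6 * \<sigma> ^ 4) = m 4 / 6"
        "(central_moment M (Y 1) 3)\<^sup>2 / (9 * \<sigma> ^ 6) = (m 3)\<^sup>2 / 9"
        unfolding central using \<open>\<sigma> > 0\<close> by (simp_all add: power_mult_distrib flip: power_mult)
      then have L: "?L = odd_double_fact k *
        (falling_fact k 2 * (m 4 / 6) + falling_fact k 3 * ((m 3)\<^sup>2 / 9) - falling_fact k 2 / 2)"
        by (metis times_divide_eq_right)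
      show ?thesis
        unfolding L unfolding C1 C2 falling_fact_2 falling_fact_3 odd_double_fact_eq
        by (simp add: field_simps power2_eq_square)
    qed
    ultimately show ?thesis
      using tendsto_mult[OF tendsto_const[of "fact (2 * k)"] fps_order_two_even_limit[OF C0, of k]]
      by (simp only:)
  qed
  note Z_moment = distributed_std_normal_moment[OF \<open>distributed N lborel Z std_normal_density\<close>]
  have odd_bigo: "(\<lambda>n. E n r - (\<integral>x. Z x ^ r \<partial>N)) \<in> O(\<lambda>n. real n powr (-1/2))"
    if "r \<le> R" "odd r" for r
  proof -
    from \<open>odd r\<close> obtain k where r: "r = 2 * k + 1" by (elim oddE)
    \<comment> \<open>The odd normal moment is zero, so the convergent sequence is the quotient of
      the two sides of the bound.\<close>
    have "sqrt (real n) * E n (2 * k + 1)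
        = (E n r - (\<integral>x. Z x ^ r \<partial>N)) / real n powr (-1/2)" if "n > 0" for n
      unfolding Z_moment r using that by (simp add: powr_minus powr_half_sqrt field_simps)
    then have "eventually (\<lambda>n. sqrt (real n) * E n (2 * k + 1)
        = (E n r - (\<integral>x. Z x ^ r \<partial>N)) / real n powr (-1/2)) sequentially"
      by (rule eventually_mono[OF ev])
    with odd_limit[of k] \<open>r \<le> R\<close> show ?thesis
      by (intro bigoI_tendsto[OF Lim_transform_eventually])
        (auto simp: r intro!: eventually_mono[OF ev])
  qed
  have even_bigo: "(\<lambda>n. E n r - (\<integral>x. Z x ^ r \<partial>N)) \<in> O(\<lambda>n. 1 / real n)"
    if "r \<le> R" "even r" for r
  proof -
    from \<open>even r\<close> obtain k where r: "r = 2 * k" by (elim evenE)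
    have "real n * (E n (2 * k) - odd_double_fact k)
        = (E n r - (\<integral>x. Z x ^ r \<partial>N)) / (1 / real n)" for n
      unfolding Z_moment r by simp
    with even_limit[of k] \<open>r \<le> R\<close> show ?thesis
      by (intro bigoI_tendsto) (auto simp: r intro!: eventually_mono[OF ev])
  qed
  show ?thesis
    unfolding E_def[symmetric] using odd_limit even_limit odd_bigo even_bigo by blast
qed

end
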